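(* Let $(K,v)$ be a valued field. For every transcendental immediate approximation type $\mathbf A$ over $(K,v)$ there exists a simple immediate transcendental extension $(K(x),v)$ of $(K,v)$ such that $\mathrm{appr}_v(x,K)=\mathbf A$. If $(K(y),v)$ is another extension field of $(K,v)$ such that $\mathrm{appr}_v(y,K)=\mathbf A$, then $y$ is also transcendental over $K$ and the isomorphism between $K(x)$ and $K(y)$ over $K$ that sends $x$ to $y$ is valuation preserving.
   Context: Valuations are Krull valuations written additively; $vK$ is the value group, $Kv$ the residue field, and $\infty$ is larger than all values. Equivalent valuations are identified. An extension $(L|K,v)$ is immediate if the canonical embeddings $vK\hookrightarrow vL$ and $Kv\hookrightarrow Lv$ are onto. Balls: for $c\in K$, the closed ball of radius $\gamma\in vK\cup\{\infty\}$ is $B_\gamma(c,K)=\{a\in K\mid v(a-c)\ge\gamma\}$, and the open ball of radius $\gamma\in vK$ is $B^\circ_\gamma(c,K)=\{a\in K\mid v(a-c)>\gamma\}$. Balls are recorded together with their radius and their kind (open/closed). An approximation type $\mathbf A$ over $(K,v)$ is a (possibly empty) collection of closed and open balls in $(K,v)$, any two of which are comparable by inclusion, such that whenever $\mathbf A$ contains a (closed or open) ball with center $c$ and radius $\gamma$, it contains $B_\beta(c,K)$ and $B_\beta^\circ(c,K)$ for all $\beta\in vK$ with $\beta<\gamma$, and whenever it contains $B^\circ_\gamma(c,K)$ it contains $B_\gamma(c,K)$. Its support $\mathrm{supp}\,\mathbf A$ is the set of all $\gamma$ such that $\mathbf A$ contains a closed ball of radius $\gamma$; this ball is then unique and denoted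 $\mathbf A_\gamma$. $\mathbf A$ is immediate if it is nonempty and the intersection of all its balls is empty. An immediate $\mathbf A$ is transcendental if for every $f\in K[X]$ there is $\delta\in\mathrm{supp}\,\mathbf A$ such that $vf(c)$ is constant for $c\in\mathbf A_\delta$. For an extension $(L|K,v)$ of valued fields and $x\in L$, $\mathrm{appr}_v(x,K)$ is the approximation type over $(K,v)$ consisting of all nonempty sets $\{c\in K\mid v(x-c)\ge\gamma\}$, $\gamma\in vK\cup\{\infty\}$ (as closed balls of radius $\gamma$), and all nonempty sets $\{c\in K\mid v(x-c)>\gamma\}$, $\gamma\in vK$ (as open balls of radius $\gamma$). *)

theory Defs
  imports
    "HOL-Computational_Algebra.Polynomial"
    "HOL-Computational_Algebra.Fraction_Field"
    "HOL-Library.Extended"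
    "Jordan_Normal_Form.Matrix"  (* provides the locale field_hom *)
begin

section \<open>Valued fields\<close>

text \<open>The value group is the set of values of nonzero elements; it need not exhaust the
  ordered group \<open>'g\<close> in which the values are taken. The element \<open>Minf\<close> of
  \<open>'g extended\<close> is excluded as a value.\<close>

definition valuation :: "('k::field \<Rightarrow> 'g::linordered_ab_group_add extended) \<Rightarrow> bool" where
  "valuation v \<longleftrightarrow>
     (\<forall>a. v a \<noteq> Minf) \<and>
     (\<forall>a. v a = Pinf \<longleftrightarrow> a = 0) \<and>
     (\<forall>a b. v (a * b) = v a + v b) \<and>
     (\<forall>a b. min (v a) (v b) \<le> v (a + b))"

definition value_group :: "('k::field \<Rightarrow> 'g::linordered_ab_group_add extended) \<Rightarrow> 'g extended set" where
  "value_group v = v ` (UNIV - {0})"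

definition valuation_ring :: "('k::field \<Rightarrow> 'g::linordered_ab_group_add extended) \<Rightarrow> 'k set" where
  "valuation_ring v = {a. 0 \<le> v a}"

text \<open>For \<open>a\<close> in the valuation ring, this is the coset of \<open>a\<close> modulo the maximal ideal.\<close>

definition residue_class :: "('k::field \<Rightarrow> 'g::linordered_ab_group_add extended) \<Rightarrow> 'k \<Rightarrow> 'k set" where
  "residue_class v a = {b. 0 < v (b - a)}"

definition residue_field :: "('k::field \<Rightarrow> 'g::linordered_ab_group_add extended) \<Rightarrow> 'k set set" where
  "residue_field v = residue_class v ` valuation_ring v"

definition equivalent_valuations ::
    "('k::field \<Rightarrow> 'g::linordered_ab_group_add extended) \<Rightarrow>
     ('k \<Rightarrow> 'h::linordered_ab_group_add extended) \<Rightarrow> bool" where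
  "equivalent_valuations v w \<longleftrightarrow> valuation_ring v = valuation_ring w"


section \<open>Extensions of valued fields\<close>

text \<open>A field extension \<open>L|K\<close> is given by a field homomorphism \<open>i\<close> from \<open>K\<close> to \<open>L\<close>. As equivalent
  valuations are identified, the restriction of the valuation of \<open>L\<close> to \<open>K\<close> is only required
  to be equivalent to that of \<open>K\<close>; in particular the value groups may live in different types.\<close>

definition valued_field_extension ::
    "('k::field \<Rightarrow> 'g::linordered_ab_group_add extended) \<Rightarrow>
     ('l::field \<Rightarrow> 'h::linordered_ab_group_add extended) \<Rightarrow> ('k \<Rightarrow> 'l) \<Rightarrow> bool" where
  "valued_field_extension v w i \<longleftrightarrow>
     valuation v \<and> valuation w \<and> field_hom i \<and> equivalent_valuations v (w \<circ> i)"

text \<open>The canonical embeddings \<open>v a \<mapsto> w (i a)\<close> of the value groups (extended by sending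
  \<open>Pinf = v 0\<close> to \<open>Pinf = w (i 0)\<close>) and of the residue fields. For an extension of valued fields,
  the element described by \<open>THE\<close> does not depend on the representative \<open>a\<close>.\<close>

definition value_embedding ::
    "('k::field \<Rightarrow> 'g::linordered_ab_group_add extended) \<Rightarrow>
     ('l::field \<Rightarrow> 'h::linordered_ab_group_add extended) \<Rightarrow> ('k \<Rightarrow> 'l) \<Rightarrow>
     'g extended \<Rightarrow> 'h extended" where
  "value_embedding v w i \<gamma> = (THE \<delta>. \<exists>a. v a = \<gamma> \<and> w (i a) = \<delta>)"

definition residue_embedding ::
    "('k::field \<Rightarrow> 'g::linordered_ab_group_add extended) \<Rightarrow>
     ('l::field \<Rightarrow> 'h::linordered_ab_group_add extended) \<Rightarrow> ('k \<Rightarrow> 'l) \<Rightarrow>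
     'k set \<Rightarrow> 'l set" where
  "residue_embedding v w i R =
     (THE S. \<exists>a\<in>valuation_ring v. residue_class v a = R \<and> residue_class w (i a) = S)"

definition immediate_extension ::
    "('k::field \<Rightarrow> 'g::linordered_ab_group_add extended) \<Rightarrow>
     ('l::field \<Rightarrow> 'h::linordered_ab_group_add extended) \<Rightarrow> ('k \<Rightarrow> 'l) \<Rightarrow> bool" where
  "immediate_extension v w i \<longleftrightarrow>
     valued_field_extension v w i \<and>
     value_embedding v w i ` value_group v = value_group w \<and>
     residue_embedding v w i ` residue_field v = residue_field w"

inductive_set adjoin :: "('k::field \<Rightarrow> 'l::field) \<Rightarrow> 'l \<Rightarrow> 'l set"
  for i :: "'k \<Rightarrow> 'l" and x :: 'l where
  base: "i a \<in> adjoin i x"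
| gen: "x \<in> adjoin i x"
| diff: "a \<in> adjoin i x \<Longrightarrow> b \<in> adjoin i x \<Longrightarrow> a - b \<in> adjoin i x"
| mult: "a \<in> adjoin i x \<Longrightarrow> b \<in> adjoin i x \<Longrightarrow> a * b \<in> adjoin i x"
| inverse: "a \<in> adjoin i x \<Longrightarrow> inverse a \<in> adjoin i x"

text \<open>The target field \<open>L\<close> of \<open>i\<close> is \<open>K(x)\<close>.\<close>

definition simple_extension :: "('k::field \<Rightarrow> 'l::field) \<Rightarrow> 'l \<Rightarrow> bool" where
  "simple_extension i x \<longleftrightarrow> adjoin i x = UNIV"

definition transcendental_over :: "('k::field \<Rightarrow> 'l::field) \<Rightarrow> 'l \<Rightarrow> bool" where
  "transcendental_over i x \<longleftrightarrow> \<not> (\<exists>f. f \<noteq> 0 \<and> poly (map_poly i f) x = 0)"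

definition isomorphism_over ::
    "('k::field \<Rightarrow> 'l::field) \<Rightarrow> ('k \<Rightarrow> 'm::field) \<Rightarrow> ('l \<Rightarrow> 'm) \<Rightarrow> bool" where
  "isomorphism_over i j \<phi> \<longleftrightarrow> field_hom \<phi> \<and> bij \<phi> \<and> (\<forall>a. \<phi> (i a) = j a)"

definition valuation_preserving ::
    "('l::field \<Rightarrow> 'h::linordered_ab_group_add extended) \<Rightarrow>
     ('m::field \<Rightarrow> 'n::linordered_ab_group_add extended) \<Rightarrow> ('l \<Rightarrow> 'm) \<Rightarrow> bool" where
  "valuation_preserving w u \<phi> \<longleftrightarrow> equivalent_valuations w (u \<circ> \<phi>)"


section \<open>Approximation types\<close>

text \<open>A ball is recorded together with its kind and its radius.\<close>

datatype ball_kind = Closed | Open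

datatype ('k, 'g) ball = Ball (kind: ball_kind) (radius: "'g extended") (points: "'k set")

definition closed_ball ::
    "('k::field \<Rightarrow> 'g::linordered_ab_group_add extended) \<Rightarrow> 'g extended \<Rightarrow> 'k \<Rightarrow> ('k, 'g) ball" where
  "closed_ball v \<gamma> c = Ball Closed \<gamma> {a. \<gamma> \<le> v (a - c)}"

definition open_ball ::
    "('k::field \<Rightarrow> 'g::linordered_ab_group_add extended) \<Rightarrow> 'g extended \<Rightarrow> 'k \<Rightarrow> ('k, 'g) ball" where
  "open_ball v \<gamma> c = Ball Open \<gamma> {a. \<gamma> < v (a - c)}"

definition balls :: "('k::field \<Rightarrow> 'g::linordered_ab_group_add extended) \<Rightarrow> ('k, 'g) ball set" where
  "balls v =
     {closed_ball v \<gamma> c | \<gamma> c. \<gamma> \<in> insert Pinf (value_group v)} \<union>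
     {open_ball v \<gamma> c | \<gamma> c. \<gamma> \<in> value_group v}"

definition approximation_type ::
    "('k::field \<Rightarrow> 'g::linordered_ab_group_add extended) \<Rightarrow> ('k, 'g) ball set \<Rightarrow> bool" where
  "approximation_type v A \<longleftrightarrow>
     A \<subseteq> balls v \<and>
     (\<forall>B\<in>A. \<forall>C\<in>A. points B \<subseteq> points C \<or> points C \<subseteq> points B) \<and>
     (\<forall>\<gamma> c. closed_ball v \<gamma> c \<in> A \<or> open_ball v \<gamma> c \<in> A \<longrightarrow>
        (\<forall>\<beta>\<in>value_group v. \<beta> < \<gamma> \<longrightarrow> closed_ball v \<beta> c \<in> A \<and> open_ball v \<beta> c \<in> A)) \<and>
     (\<forall>\<gamma> c. open_ball v \<gamma> c \<in> A \<longrightarrow> closed_ball v \<gamma> c \<in> A)"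

definition supp :: "('k, 'g) ball set \<Rightarrow> 'g extended set" where
  "supp A = {\<gamma>. \<exists>B\<in>A. kind B = Closed \<and> radius B = \<gamma>}"

definition closed_at :: "('k, 'g) ball set \<Rightarrow> 'g extended \<Rightarrow> 'k set" where
  "closed_at A \<gamma> = (THE S. Ball Closed \<gamma> S \<in> A)"

definition immediate_approximation_type ::
    "('k::field \<Rightarrow> 'g::linordered_ab_group_add extended) \<Rightarrow> ('k, 'g) ball set \<Rightarrow> bool" where
  "immediate_approximation_type v A \<longleftrightarrow>
     approximation_type v A \<and> A \<noteq> {} \<and> (\<Inter>B\<in>A. points B) = {}"

definition transcendental_immediate_approximation_type ::
    "('k::field \<Rightarrow> 'g::linordered_ab_group_add extended) \<Rightarrow> ('k, 'g) ball set \<Rightarrow> bool" where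
  "transcendental_immediate_approximation_type v A \<longleftrightarrow>
     immediate_approximation_type v A \<and>
     (\<forall>f::'k poly. \<exists>\<delta>\<in>supp A. \<exists>\<alpha>. \<forall>c\<in>closed_at A \<delta>. v (poly f c) = \<alpha>)"

text \<open>Radii are elements of \<open>vK\<close>; they are compared with values in the extension along the canonical
  embedding.\<close>

definition appr ::
    "('k::field \<Rightarrow> 'g::linordered_ab_group_add extended) \<Rightarrow>
     ('l::field \<Rightarrow> 'h::linordered_ab_group_add extended) \<Rightarrow> ('k \<Rightarrow> 'l) \<Rightarrow> 'l \<Rightarrow> ('k, 'g) ball set" where
  "appr v w i x =
     {Ball Closed \<gamma> S | \<gamma> S. \<gamma> \<in> insert Pinf (value_group v) \<and>
        S = {c. value_embedding v w i \<gamma> \<le> w (x - i c)} \<and> S \<noteq> {}} \<union>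
     {Ball Open \<gamma> S | \<gamma> S. \<gamma> \<in> value_group v \<and>
        S = {c. value_embedding v w i \<gamma> < w (x - i c)} \<and> S \<noteq> {}}"

end

theory Submission
  imports Defs
begin

text \<open>
  The balls of \<open>A\<close> form a chain of nonempty sets, so they are a base of a proper filter on \<open>K\<close>. A
  transcendental \<open>A\<close> makes \<open>v (f d)\<close> eventually constant along this filter for every polynomial \<open>f\<close>;
  hence the same holds for every rational function, and sending a rational function to the eventual
  value is a valuation on \<open>K(X)\<close> extending \<open>v\<close>: each axiom holds at every \<open>d\<close> where the denominators
  do not vanish, and the filter avoids the finitely many zeros of a nonzero polynomial.
  Since the balls have no common point, a ball of \<open>A\<close> is recognised by the fact that \<open>d\<close>
  eventually lies in it, and so \<open>X\<close> has approximation type \<open>A\<close> (\<open>appr_limit_value\<close>).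

  That this extension is immediate, and that it is the only possible one, has a single reason
  (\<open>ex_leading_term_poly\<close>). Let \<open>x\<close> be an element of some extension of \<open>K\<close> that the points of the
  filter approach. Then every nonzero polynomial \<open>f\<close> has an \<open>r\<close> in \<open>K\<close> with the same leading term
  (the same class modulo the \<open>1\<close>-units) as \<open>f(x)\<close> and as \<open>f(d)\<close> for eventually all \<open>d\<close>. For linear
  polynomials this expresses that the balls have an empty intersection. For higher degree, choose \<open>c\<close>
  so late that \<open>v (f c)\<close> is the eventual value \<open>\<alpha>\<close> and write \<open>f = f(c) + (X - c) g\<close>. By induction the
  product \<open>(X - c) g\<close> has a leading term \<open>s\<close>, and \<open>v s \<ge> \<alpha>\<close> because \<open>s\<close> has the value of \<open>f(d) - f(c)\<close>.
  So \<open>r = f(c) + s\<close> misses \<open>f\<close> by something of value above \<open>v s \<ge> \<alpha>\<close>, which makes it a leading term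
  of \<open>f\<close>.

  Taking quotients, every nonzero element of \<open>K(X)\<close> shares its leading term with an element of \<open>K\<close>,
  which is immediacy. If \<open>y\<close> is any element with approximation type \<open>A\<close>, then \<open>f(y)\<close> has the leading
  term of an element of \<open>K\<close>; so it does not vanish, and its value is the eventual value of \<open>f(d)\<close>.
  Thus \<open>y\<close> is transcendental and the valuation of \<open>K(y)\<close> is determined by \<open>A\<close> alone.
\<close>


section \<open>Arithmetic of valuations\<close>

context
  fixes v :: "'k::field \<Rightarrow> 'g::linordered_ab_group_add extended"
  assumes v: "valuation v"
begin

lemma valuation_eq_Pinf_iff: "v a = Pinf \<longleftrightarrow> a = 0"
  and valuation_mult: "v (a * b) = v a + v b"
  and valuation_add_ge_min: "min (v a) (v b) \<le> v (a + b)"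
  using v unfolding valuation_def by blast+

lemma valuation_zero: "v 0 = Pinf"
  by (simp add: valuation_eq_Pinf_iff)

lemma valuation_nonzero_cases:
  assumes "a \<noteq> 0"
  obtains g where "v a = Fin g"
  using assms v unfolding valuation_def by (cases "v a") auto

lemma valuation_one: "v 1 = 0"
proof -
  obtain g where g: "v 1 = Fin g"
    by (rule valuation_nonzero_cases[of 1]) auto
  with valuation_mult[of 1 1] show ?thesis
    by (simp add: zero_extended_def)
qed

lemma valuation_uminus: "v (- a) = v a"
proof -
  obtain g where g: "v (-1) = Fin g"
    by (rule valuation_nonzero_cases[of "-1"]) auto
  have "g + g = 0"
    using valuation_mult[of "-1" "-1"] g by (simp add: valuation_one zero_extended_def)
  then have "v (-1) = 0"
    using g by (simp add: zero_extended_def)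
  then show ?thesis
    using valuation_mult[of "-1" a] by simp
qed

lemma valuation_minus_commute: "v (a - b) = v (b - a)"
  using valuation_uminus[of "a - b"] by simp

lemma valuation_add_ge: "\<gamma> \<le> v a \<Longrightarrow> \<gamma> \<le> v b \<Longrightarrow> \<gamma> \<le> v (a + b)"
  using valuation_add_ge_min[of a b] by (meson min.boundedI order_trans)

lemma valuation_add_greater: "\<gamma> < v a \<Longrightarrow> \<gamma> < v b \<Longrightarrow> \<gamma> < v (a + b)"
  using valuation_add_ge_min[of a b] by (meson min_less_iff_conj less_le_trans)

lemma valuation_diff_ge: "\<gamma> \<le> v a \<Longrightarrow> \<gamma> \<le> v b \<Longrightarrow> \<gamma> \<le> v (a - b)"
  using valuation_add_ge[of \<gamma> a "- b"] by (simp add: valuation_uminus)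

lemma valuation_diff_greater: "\<gamma> < v a \<Longrightarrow> \<gamma> < v b \<Longrightarrow> \<gamma> < v (a - b)"
  using valuation_add_greater[of \<gamma> a "- b"] by (simp add: valuation_uminus)

lemma valuation_add_eq:
  assumes "v a < v b"
  shows "v (a + b) = v a"
proof (rule antisym)
  show "v a \<le> v (a + b)"
    using assms by (intro valuation_add_ge) auto
  show "v (a + b) \<le> v a"
  proof (rule ccontr)
    assume "\<not> v (a + b) \<le> v a"
    then have "v a < v ((a + b) - b)"
      using assms by (intro valuation_diff_greater) auto
    then show False by simp
  qed
qed

lemma valuation_mult_le_iff:
  assumes "c \<noteq> 0"
  shows "v (c * a) \<le> v (c * b) \<longleftrightarrow> v a \<le> v b"
proof -
  obtain g where "v c = Fin g"
    by (rule valuation_nonzero_cases[OF assms])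
  moreover have "v a \<noteq> Minf" "v b \<noteq> Minf"
    using v unfolding valuation_def by blast+
  ultimately show ?thesis
    by (cases "v a"; cases "v b") (simp_all add: valuation_mult)
qed

lemma valuation_mult_less_iff:
  assumes "c \<noteq> 0"
  shows "v (c * a) < v (c * b) \<longleftrightarrow> v a < v b"
  using valuation_mult_le_iff[OF assms, of b a] by (simp flip: not_le)

lemma valuation_divide_nonneg_iff:
  assumes "b \<noteq> 0"
  shows "0 \<le> v (a / b) \<longleftrightarrow> v b \<le> v a"
  using valuation_mult_le_iff[OF assms, of 1 "a / b"] assms by (simp add: valuation_one)

lemma valuation_divide:
  assumes "b \<noteq> 0"
  shows "v (a / b) = v a - v b"
proof -
  obtain g where "v b = Fin g"
    by (rule valuation_nonzero_cases[OF assms])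
  moreover have "v a = v b + v (a / b)"
    using valuation_mult[of b "a / b"] assms by simp
  moreover have "v (a / b) \<noteq> Minf"
    using v unfolding valuation_def by blast
  ultimately show ?thesis
    by (cases "v (a / b)") simp_all
qed

end


section \<open>Leading terms\<close>

text \<open>
  Equality in the leading term structure of the valued field, the quotient of the multiplicative group
  by the \<open>1\<close>-units. The strict inequality excludes zero on both sides, which is what later yields
  that polynomials do not vanish.
\<close>

definition same_leading_term ::
    "('k::field \<Rightarrow> 'g::linordered_ab_group_add extended) \<Rightarrow> 'k \<Rightarrow> 'k \<Rightarrow> bool" where
  "same_leading_term v a b \<longleftrightarrow> v a < v (b - a)"

context
  fixes v :: "'k::field \<Rightarrow> 'g::linordered_ab_group_add extended"
  assumes v: "valuation v"
begin

lemma same_leading_term_value: "same_leading_term v a b \<Longrightarrow> v b = v a"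
  using valuation_add_eq[OF v, of a "b - a"] by (simp add: same_leading_term_def)

lemma same_leading_term_nonzero:
  assumes "same_leading_term v a b"
  shows "a \<noteq> 0" "b \<noteq> 0"
  using assms same_leading_term_value[OF assms] valuation_eq_Pinf_iff[OF v]
  by (auto simp: same_leading_term_def valuation_uminus[OF v])

lemma same_leading_term_refl: "a \<noteq> 0 \<Longrightarrow> same_leading_term v a a"
  using valuation_eq_Pinf_iff[OF v, of a]
  by (cases "v a") (simp_all add: same_leading_term_def valuation_zero[OF v])

lemma same_leading_term_sym: "same_leading_term v a b \<Longrightarrow> same_leading_term v b a"
  using same_leading_term_value[of a b] valuation_minus_commute[OF v, of a b]
  by (simp add: same_leading_term_def)

lemma same_leading_term_mult:
  assumes "same_leading_term v a b" "same_leading_term v a' b'"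
  shows "same_leading_term v (a * a') (b * b')"
proof -
  note nz = same_leading_term_nonzero[OF assms(1)] same_leading_term_nonzero[OF assms(2)]
  have "v (b * a') < v (b * (b' - a'))"
    using assms(2) nz by (simp add: same_leading_term_def valuation_mult_less_iff[OF v])
  moreover have "v (a' * a) < v (a' * (b - a))"
    using assms(1) nz by (simp add: same_leading_term_def valuation_mult_less_iff[OF v])
  moreover have "v (b * a') = v (a * a')"
    using same_leading_term_value[OF assms(1)] by (simp add: valuation_mult[OF v])
  ultimately have "v (a * a') < v (b * (b' - a') + a' * (b - a))"
    by (intro valuation_add_greater[OF v]) (simp_all add: mult.commute)
  then show ?thesis
    by (simp add: same_leading_term_def algebra_simps)
qed

lemma same_leading_term_inverse:
  assumes "same_leading_term v a b"
  shows "same_leading_term v (inverse a) (inverse b)"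
proof -
  note nz = same_leading_term_nonzero[OF assms]
  have "v b < v (a - b)"
    using same_leading_term_sym[OF assms] by (simp add: same_leading_term_def)
  moreover have "b = (a * b) * inverse a" "a - b = (a * b) * (inverse b - inverse a)"
    using nz by (simp_all add: field_simps)
  ultimately have "v ((a * b) * inverse a) < v ((a * b) * (inverse b - inverse a))"
    by metis
  then show ?thesis
    using nz by (simp add: same_leading_term_def valuation_mult_less_iff[OF v])
qed

lemma same_leading_term_divide:
  assumes "same_leading_term v a b" "same_leading_term v a' b'"
  shows "same_leading_term v (a / a') (b / b')"
  using same_leading_term_mult[OF assms(1) same_leading_term_inverse[OF assms(2)]]
  by (simp add: divide_inverse)

end


section \<open>Extensions of valued fields\<close>

text \<open>
  Equivalent valuations need not agree, but they order the field in the same way, as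
  \<open>v a \<le> v b\<close> says that \<open>b / a\<close> is in the valuation ring. All comparisons between \<open>K\<close> and its
  extensions go through this fact.
\<close>

lemma valued_field_extension_le_iff:
  assumes "valued_field_extension v w i"
  shows "w (i a) \<le> w (i b) \<longleftrightarrow> v a \<le> v b"
proof -
  have v: "valuation v" and w: "valuation w"
    and eq: "valuation_ring v = valuation_ring (w \<circ> i)"
    using assms by (auto simp: valued_field_extension_def equivalent_valuations_def)
  interpret i: field_hom i
    using assms by (simp add: valued_field_extension_def)
  show ?thesis
  proof (cases "a = 0")
    case True
    then show ?thesis
      by (simp add: valuation_zero[OF v] valuation_zero[OF w]
          valuation_eq_Pinf_iff[OF v] valuation_eq_Pinf_iff[OF w])
  next
    case False
    have "w (i a) \<le> w (i b) \<longleftrightarrow> 0 \<le> w (i b / i a)"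
      using False valuation_divide_nonneg_iff[OF w, of "i a" "i b"] by simp
    also have "\<dots> \<longleftrightarrow> b / a \<in> valuation_ring (w \<circ> i)"
      by (simp add: valuation_ring_def i.hom_div)
    also have "\<dots> \<longleftrightarrow> v a \<le> v b"
      using False unfolding eq[symmetric]
      by (simp add: valuation_ring_def valuation_divide_nonneg_iff[OF v])
    finally show ?thesis .
  qed
qed

lemma valued_field_extension_less_iff:
  assumes "valued_field_extension v w i"
  shows "w (i a) < w (i b) \<longleftrightarrow> v a < v b"
  using valued_field_extension_le_iff[OF assms, of b a] by (simp flip: not_le)

lemma value_embedding_value:
  assumes "valued_field_extension v w i"
  shows "value_embedding v w i (v a) = w (i a)"
  unfolding value_embedding_def
proof (rule the_equality)
  fix \<delta> assume "\<exists>b. v b = v a \<and> w (i b) = \<delta>"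
  then show "\<delta> = w (i a)"
    using valued_field_extension_le_iff[OF assms]
    by (metis order_antisym order_refl)
qed blast

lemma residue_class_eqI:
  assumes v: "valuation v" and "0 < v (b - a)"
  shows "residue_class v a = residue_class v b"
proof -
  have "0 < v (c - a) \<longleftrightarrow> 0 < v (c - b)" for c
    using valuation_diff_greater[OF v, of 0 "c - a" "b - a"]
      valuation_add_greater[OF v, of 0 "c - b" "b - a"] assms(2) by auto
  then show ?thesis
    by (simp add: residue_class_def)
qed

lemma residue_embedding_residue_class:
  assumes ext: "valued_field_extension v w i" and a: "a \<in> valuation_ring v"
  shows "residue_embedding v w i (residue_class v a) = residue_class w (i a)"
  unfolding residue_embedding_def
proof (rule the_equality)
  have v: "valuation v" and w: "valuation w"
    using ext by (auto simp: valued_field_extension_def)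
  interpret i: field_hom i
    using ext by (simp add: valued_field_extension_def)
  fix S assume "\<exists>b\<in>valuation_ring v. residue_class v b = residue_class v a \<and> residue_class w (i b) = S"
  then obtain b where eq: "residue_class v b = residue_class v a" and S: "S = residue_class w (i b)"
    by blast
  have "0 < v 0"
    by (simp add: valuation_zero[OF v] zero_extended_def)
  then have "a \<in> residue_class v b"
    unfolding eq by (simp add: residue_class_def)
  then have "v 1 < v (a - b)"
    by (simp add: residue_class_def valuation_one[OF v])
  then have "0 < w (i a - i b)"
    using valued_field_extension_less_iff[OF ext, of 1 "a - b"]
    by (simp add: valuation_one[OF w] i.hom_minus)
  then show "S = residue_class w (i a)"
    unfolding S by (rule residue_class_eqI[OF w])
qed (use a in blast)

text \<open>
  Leading terms determine both the value and, for elements of value \<open>0\<close>, the residue class. Elements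
  of positive value all have the residue class of \<open>0\<close>.
\<close>

lemma immediate_extension_if_leading_terms:
  assumes ext: "valued_field_extension v w i"
    and lead: "\<And>q. q \<noteq> 0 \<Longrightarrow> \<exists>r. same_leading_term w (i r) q"
  shows "immediate_extension v w i"
proof -
  have v: "valuation v" and w: "valuation w"
    using ext by (auto simp: valued_field_extension_def)
  interpret i: field_hom i
    using ext by (simp add: valued_field_extension_def)
  have "value_embedding v w i ` value_group v = w ` i ` (UNIV - {0})"
    unfolding value_group_def
    by (simp add: image_image value_embedding_value[OF ext])
  also have "\<dots> = value_group w"
  proof
    show "w ` i ` (UNIV - {0}) \<subseteq> value_group w"
      by (auto simp: value_group_def)
    show "value_group w \<subseteq> w ` i ` (UNIV - {0})"
    proof
      fix \<gamma> assume "\<gamma> \<in> value_group w"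
      then obtain q where q: "q \<noteq> 0" "\<gamma> = w q"
        by (auto simp: value_group_def)
      then obtain r where r: "same_leading_term w (i r) q"
        using lead by blast
      then show "\<gamma> \<in> w ` i ` (UNIV - {0})"
        using q same_leading_term_value[OF w r] same_leading_term_nonzero[OF w r] by auto
    qed
  qed
  finally have vg: "value_embedding v w i ` value_group v = value_group w" .
  have ring: "0 \<le> w (i a) \<longleftrightarrow> 0 \<le> v a" for a
    using valued_field_extension_le_iff[OF ext, of 1 a]
    by (simp add: valuation_one[OF v] valuation_one[OF w])
  have "residue_embedding v w i ` residue_field v = (\<lambda>a. residue_class w (i a)) ` valuation_ring v"
    unfolding residue_field_def
    by (auto simp: image_image residue_embedding_residue_class[OF ext] cong: image_cong)
  also have "\<dots> = residue_field w"
  proof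
    show "(\<lambda>a. residue_class w (i a)) ` valuation_ring v \<subseteq> residue_field w"
      using ring by (auto simp: residue_field_def valuation_ring_def)
    show "residue_field w \<subseteq> (\<lambda>a. residue_class w (i a)) ` valuation_ring v"
    proof
      fix S assume "S \<in> residue_field w"
      then obtain q where q: "0 \<le> w q" "S = residue_class w q"
        by (auto simp: residue_field_def valuation_ring_def)
      have "\<exists>r. 0 \<le> w (i r) \<and> 0 < w (q - i r)"
      proof (cases "q = 0")
        case True
        then show ?thesis
          by (intro exI[of _ 0]) (simp add: valuation_zero[OF w] zero_extended_def)
      next
        case False
        then obtain r where r: "same_leading_term w (i r) q"
          using lead by blast
        then show ?thesis
          using q same_leading_term_value[OF w r]
          by (intro exI[of _ r]) (auto simp: same_leading_term_def)
      qed
      then obtain r where "0 \<le> w (i r)" "0 < w (q - i r)"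
        by blast
      then show "S \<in> (\<lambda>a. residue_class w (i a)) ` valuation_ring v"
        using q residue_class_eqI[OF w, of q "i r"] ring by (auto simp: valuation_ring_def)
    qed
  qed
  finally show ?thesis
    using ext vg by (simp add: immediate_extension_def)
qed


section \<open>Leading terms of polynomials along a filter\<close>

lemma (in field_hom) map_poly_pCons_hom: "map_poly hom (pCons a p) = pCons (hom a) (map_poly hom p)"
  by (rule map_poly_pCons) simp

lemma (in field_hom) idom_hom_poly_map_poly: "idom_hom (\<lambda>f. poly (map_poly hom f) y)"
proof
  show add: "poly (map_poly hom (p + q)) y = poly (map_poly hom p) y + poly (map_poly hom q) y" for p q
  proof -
    have "map_poly hom (p + q) = map_poly hom p + map_poly hom q"
      by (rule poly_eqI) (simp add: coeff_map_poly hom_add)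
    then show ?thesis by simp
  qed
  have "poly (map_poly hom (Polynomial.smult a q)) y = hom a * poly (map_poly hom q) y" for a q
    by (subst map_poly_smult) (simp_all add: hom_mult)
  then show "poly (map_poly hom (p * q)) y = poly (map_poly hom p) y * poly (map_poly hom q) y" for p q
    by (induction p) (simp_all add: map_poly_pCons_hom add algebra_simps)
qed simp_all

text \<open>
  What remains of a transcendental immediate approximation type once its balls are replaced by the
  filter that they generate. The last condition says that some \<open>b = a + r\<close> is eventually closer to
  \<open>d\<close> than \<open>a\<close> is: no point of \<open>K\<close> is a best approximation.
\<close>

locale transcendental_filter =
  fixes v :: "'k::field \<Rightarrow> 'g::linordered_ab_group_add extended" and F :: "'k filter"
  assumes v: "valuation v"
    and F: "F \<noteq> bot"
    and poly_value: "\<And>f. \<exists>\<alpha>. \<forall>\<^sub>F d in F. v (poly f d) = \<alpha>"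
    and leading_term_diff: "\<And>a. \<exists>r. \<forall>\<^sub>F d in F. same_leading_term v r (d - a)"
begin

text \<open>
  The same condition for an element \<open>x\<close> of an extension, with the same \<open>r\<close>: seen from \<open>K\<close>, the
  element \<open>x\<close> cannot be told apart from \<open>d\<close> far along the filter.
\<close>

definition limit_point ::
    "('l::field \<Rightarrow> 'h::linordered_ab_group_add extended) \<Rightarrow> ('k \<Rightarrow> 'l) \<Rightarrow> 'l \<Rightarrow> bool" where
  "limit_point w i x \<longleftrightarrow>
     (\<forall>a. \<exists>r. (\<forall>\<^sub>F d in F. same_leading_term v r (d - a)) \<and> same_leading_term w (i r) (x - i a))"

text \<open>
  Since \<open>r\<close> serves for \<open>f(d)\<close> and for \<open>f(x)\<close>, the value of \<open>f(x)\<close> is forced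
  by the filter; since \<open>r\<close> lies in \<open>K\<close>, the extension generated by \<open>x\<close> adds no leading terms.
\<close>

lemma ex_leading_term_poly:
  assumes ext: "valued_field_extension v w i" and x: "limit_point w i x"
  shows "f \<noteq> 0 \<Longrightarrow> \<exists>r. (\<forall>\<^sub>F d in F. same_leading_term v r (poly f d)) \<and>
    same_leading_term w (i r) (poly (map_poly i f) x)"
proof (induction "degree f" arbitrary: f rule: less_induct)
  case less
  have w: "valuation w"
    using ext by (simp add: valued_field_extension_def)
  interpret i: field_hom i
    using ext by (simp add: valued_field_extension_def)
  interpret ev: idom_hom "\<lambda>f. poly (map_poly i f) x"
    by (rule i.idom_hom_poly_map_poly)
  show ?case
  proof (cases "degree f = 0")
    case True
    then obtain a where f: "f = [:a:]"
      by (rule degree_eq_zeroE)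
    then have "a \<noteq> 0"
      using less.prems by simp
    then have "same_leading_term v a a" "same_leading_term w (i a) (i a)"
      using same_leading_term_refl[OF v, of a] same_leading_term_refl[OF w, of "i a"] by auto
    then show ?thesis
      unfolding f by (intro exI[of _ a]) (simp add: i.map_poly_pCons_hom)
  next
    case False
    obtain \<alpha> where \<alpha>: "\<forall>\<^sub>F d in F. v (poly f d) = \<alpha>"
      using poly_value by blast
    then obtain c where c: "v (poly f c) = \<alpha>"
      using eventually_happens'[OF F] by blast
    define g where "g = synthetic_div f c"
    have f: "f = [:- c, 1:] * g + [:poly f c:]"
      unfolding g_def using synthetic_div_correct'[of c f] by simp
    have "degree g < degree f"
      using False by (simp add: g_def degree_synthetic_div)
    moreover have "g \<noteq> 0"
      using False f by (metis add_0 degree_pCons_0 mult_zero_right)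
    ultimately obtain r where
      r: "\<forall>\<^sub>F d in F. same_leading_term v r (poly g d)"
         "same_leading_term w (i r) (poly (map_poly i g) x)"
      using less.hyps by blast
    obtain t where
      t: "\<forall>\<^sub>F d in F. same_leading_term v t (d - c)" "same_leading_term w (i t) (x - i c)"
      using x unfolding limit_point_def by blast
    \<comment> \<open>the common leading term of \<open>f(d) - f(c)\<close> and \<open>f(x) - f(c)\<close>\<close>
    define s where "s = t * r"
    have poly_f: "poly f d - poly f c = (d - c) * poly g d" for d
      by (subst f) (simp add: algebra_simps)
    have poly_fx: "poly (map_poly i f) x - i (poly f c) = (x - i c) * poly (map_poly i g) x"
    proof -
      have "poly (map_poly i f) x =
          poly (map_poly i [:- c, 1:]) x * poly (map_poly i g) x + poly (map_poly i [:poly f c:]) x"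
        by (subst f) (simp only: ev.hom_add ev.hom_mult)
      then show ?thesis
        by (simp add: i.map_poly_pCons_hom i.hom_uminus)
    qed
    have s: "\<forall>\<^sub>F d in F. same_leading_term v s (poly f d - poly f c)"
      using t(1) r(1) unfolding poly_f s_def
      by eventually_elim (rule same_leading_term_mult[OF v])
    have sx: "same_leading_term w (i s) (poly (map_poly i f) x - i (poly f c))"
      unfolding poly_fx s_def i.hom_mult by (rule same_leading_term_mult[OF w t(2) r(2)])
    \<comment> \<open>both \<open>f(d)\<close> and \<open>f(c)\<close> have value \<open>\<alpha>\<close>; this is where the choice of \<open>c\<close> enters\<close>
    have s_ge: "\<alpha> \<le> v s"
    proof -
      obtain d where "same_leading_term v s (poly f d - poly f c)" "v (poly f d) = \<alpha>"
        using eventually_happens'[OF F eventually_conj[OF s \<alpha>]] by blast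
      then show ?thesis
        using same_leading_term_value[OF v, of s "poly f d - poly f c"]
          valuation_diff_ge[OF v, of \<alpha> "poly f d" "poly f c"] c
        by simp
    qed
    have lead: "\<forall>\<^sub>F d in F. same_leading_term v (poly f c + s) (poly f d)"
      using s \<alpha>
    proof eventually_elim
      case (elim d)
      then have "v (poly f d) < v (poly f d - (poly f c + s))"
        using s_ge by (simp add: same_leading_term_def algebra_simps)
      then have "same_leading_term v (poly f d) (poly f c + s)"
        by (simp add: same_leading_term_def valuation_minus_commute[OF v])
      then show ?case
        by (rule same_leading_term_sym[OF v])
    qed
    obtain d where "same_leading_term v (poly f c + s) (poly f d)" "v (poly f d) = \<alpha>"
      using eventually_happens'[OF F eventually_conj[OF lead \<alpha>]] by blast
    then have "v (poly f c + s) = \<alpha>"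
      using same_leading_term_value[OF v] by simp
    then have "w (i (poly f c + s)) \<le> w (i s)"
      using s_ge by (simp add: valued_field_extension_le_iff[OF ext])
    also have "\<dots> < w (poly (map_poly i f) x - i (poly f c + s))"
      using sx by (simp add: same_leading_term_def i.hom_add algebra_simps)
    finally have "same_leading_term w (i (poly f c + s)) (poly (map_poly i f) x)"
      by (simp add: same_leading_term_def)
    with lead show ?thesis
      by blast
  qed
qed

lemma poly_limit_point_nonzero:
  assumes "valued_field_extension v w i" "limit_point w i x" "f \<noteq> 0"
  shows "poly (map_poly i f) x \<noteq> 0"
proof -
  have "valuation w"
    using assms(1) by (simp add: valued_field_extension_def)
  then show ?thesis
    using ex_leading_term_poly[OF assms] same_leading_term_nonzero by blast
qed

lemma transcendental_limit_point:
  assumes "valued_field_extension v w i" "limit_point w i x"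
  shows "transcendental_over i x"
  using poly_limit_point_nonzero[OF assms] by (auto simp: transcendental_over_def)

text \<open>
  The right-hand side is the same for all extensions. Hence any two limit points induce
  the same ordering of values on polynomials, in whichever extensions they live.
\<close>

lemma poly_limit_point_le_iff:
  assumes ext: "valued_field_extension v w i" and x: "limit_point w i x" and "f \<noteq> 0" "g \<noteq> 0"
  shows "w (poly (map_poly i f) x) \<le> w (poly (map_poly i g) x) \<longleftrightarrow>
    (\<forall>\<^sub>F d in F. v (poly f d) \<le> v (poly g d))"
proof -
  have w: "valuation w"
    using ext by (simp add: valued_field_extension_def)
  obtain r where r: "\<forall>\<^sub>F d in F. same_leading_term v r (poly f d)"
      "same_leading_term w (i r) (poly (map_poly i f) x)"
    using ex_leading_term_poly[OF ext x] assms by blast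
  obtain s where s: "\<forall>\<^sub>F d in F. same_leading_term v s (poly g d)"
      "same_leading_term w (i s) (poly (map_poly i g) x)"
    using ex_leading_term_poly[OF ext x] assms by blast
  have "(\<forall>\<^sub>F d in F. v (poly f d) \<le> v (poly g d)) \<longleftrightarrow> (\<forall>\<^sub>F d in F. v r \<le> v s)"
    using eventually_conj[OF r(1) s(1)]
    by (rule eventually_subst[OF eventually_mono]) (auto simp: same_leading_term_value[OF v])
  also have "\<dots> \<longleftrightarrow> v r \<le> v s"
    using F by (simp add: eventually_const)
  finally show ?thesis
    using same_leading_term_value[OF w r(2)] same_leading_term_value[OF w s(2)]
    by (simp add: valued_field_extension_le_iff[OF ext])
qed

end


section \<open>Simple transcendental extensions\<close>

lemma adjoin_transcendental_cases:
  assumes i: "field_hom i" and x: "transcendental_over i x" and "z \<in> adjoin i x"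
  obtains f g where "g \<noteq> 0" "z = poly (map_poly i f) x / poly (map_poly i g) x"
proof -
  interpret i: field_hom i by fact
  interpret ev: idom_hom "\<lambda>f. poly (map_poly i f) x"
    by (rule i.idom_hom_poly_map_poly)
  have nz: "poly (map_poly i g) x \<noteq> 0" if "g \<noteq> 0" for g
    using x that by (auto simp: transcendental_over_def)
  have "\<exists>f g. g \<noteq> 0 \<and> z = poly (map_poly i f) x / poly (map_poly i g) x"
    using \<open>z \<in> adjoin i x\<close>
  proof induction
    case (base a)
    then show ?case
      by (intro exI[of _ "[:a:]"] exI[of _ 1]) (simp add: i.map_poly_pCons_hom)
  next
    case gen
    then show ?case
      by (intro exI[of _ "[:0, 1:]"] exI[of _ 1]) (simp add: i.map_poly_pCons_hom)
  next
    case (diff a b)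
    then obtain f g f' g' where *: "g \<noteq> 0" "g' \<noteq> 0"
      "a = poly (map_poly i f) x / poly (map_poly i g) x"
      "b = poly (map_poly i f') x / poly (map_poly i g') x"
      by blast
    then have "a - b = poly (map_poly i (f * g' - f' * g)) x / poly (map_poly i (g * g')) x"
      by (simp add: ev.hom_mult ev.hom_minus nz diff_frac_eq)
    then show ?case
      using * by (metis no_zero_divisors)
  next
    case (mult a b)
    then obtain f g f' g' where *: "g \<noteq> 0" "g' \<noteq> 0"
      "a = poly (map_poly i f) x / poly (map_poly i g) x"
      "b = poly (map_poly i f') x / poly (map_poly i g') x"
      by blast
    then have "a * b = poly (map_poly i (f * f')) x / poly (map_poly i (g * g')) x"
      by (simp add: ev.hom_mult)
    then show ?case
      using * by (metis no_zero_divisors)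
  next
    case (inverse a)
    then obtain f g where *: "g \<noteq> 0" "a = poly (map_poly i f) x / poly (map_poly i g) x"
      by blast
    show ?case
    proof (cases "f = 0")
      case True
      then show ?thesis
        using * by (intro exI[of _ 0] exI[of _ 1]) simp
    next
      case False
      then show ?thesis
        using * by (intro exI[of _ g] exI[of _ f]) simp
    qed
  qed
  then show thesis
    using that by blast
qed

lemma hom_poly_map_poly:
  assumes i: "field_hom i" and j: "field_hom j" and \<phi>: "isomorphism_over i j \<phi>"
  shows "\<phi> (poly (map_poly i f) x) = poly (map_poly j f) (\<phi> x)"
proof -
  interpret i: field_hom i by fact
  interpret j: field_hom j by fact
  interpret phi: field_hom \<phi>
    using \<phi> by (simp add: isomorphism_over_def)
  show ?thesis
    using \<phi> by (induction f) (simp_all add: i.map_poly_pCons_hom j.map_poly_pCons_hom phi.hom_add phi.hom_mult isomorphism_over_def)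
qed

lemma isomorphism_over_unique:
  assumes "isomorphism_over i j \<phi>" "isomorphism_over i j \<psi>" "\<phi> x = \<psi> x" "simple_extension i x"
  shows "\<phi> = \<psi>"
proof
  interpret phi: field_hom \<phi>
    using assms by (simp add: isomorphism_over_def)
  interpret psi: field_hom \<psi>
    using assms by (simp add: isomorphism_over_def)
  fix z
  have "z \<in> adjoin i x"
    using assms by (simp add: simple_extension_def)
  then show "\<phi> z = \<psi> z"
    by induction (use assms in \<open>auto simp: isomorphism_over_def phi.hom_mult psi.hom_mult
      phi.hom_minus psi.hom_minus phi.hom_inverse psi.hom_inverse\<close>)
qed

text \<open>
  Both fields are fields of fractions of their copies of \<open>K[X]\<close>, so \<open>f(x) / g(x) \<mapsto> f(y) / g(y)\<close> is
  well defined: by transcendence, equal fractions come from equal cross products of polynomials.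
\<close>

lemma ex_isomorphism_over:
  fixes i :: "'k::field \<Rightarrow> 'l::field" and j :: "'k \<Rightarrow> 'm::field"
  assumes i: "field_hom i" "simple_extension i x" "transcendental_over i x"
    and j: "field_hom j" "simple_extension j y" "transcendental_over j y"
  shows "\<exists>\<phi>. isomorphism_over i j \<phi> \<and> \<phi> x = y"
proof -
  interpret i: field_hom i by fact
  interpret j: field_hom j by fact
  define E where "E f = poly (map_poly i f) x" for f
  define E' where "E' f = poly (map_poly j f) y" for f
  interpret E: idom_hom E
    unfolding E_def by (rule i.idom_hom_poly_map_poly)
  interpret E': idom_hom E'
    unfolding E'_def by (rule j.idom_hom_poly_map_poly)
  have E_0: "E f = 0 \<longleftrightarrow> f = 0" for f
    using i(3) by (auto simp: transcendental_over_def E_def)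
  have E'_0: "E' f = 0 \<longleftrightarrow> f = 0" for f
    using j(3) by (auto simp: transcendental_over_def E'_def)
  have E_cases: "\<exists>f g. g \<noteq> 0 \<and> z = E f / E g" for z
    using adjoin_transcendental_cases[OF i(1,3), of z] i(2)
    unfolding E_def simple_extension_def by (metis UNIV_I)
  have E'_cases: "\<exists>f g. g \<noteq> 0 \<and> z = E' f / E' g" for z
    using adjoin_transcendental_cases[OF j(1,3), of z] j(2)
    unfolding E'_def simple_extension_def by (metis UNIV_I)
  define \<phi> where "\<phi> z = (THE t. \<exists>f g. g \<noteq> 0 \<and> z = E f / E g \<and> t = E' f / E' g)" for z
  have \<phi>: "\<phi> (E f / E g) = E' f / E' g" if "g \<noteq> 0" for f g
    unfolding \<phi>_def
  proof (rule the_equality)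
    fix t assume "\<exists>f' g'. g' \<noteq> 0 \<and> E f / E g = E f' / E g' \<and> t = E' f' / E' g'"
    then obtain f' g' where *: "g' \<noteq> 0" "E f / E g = E f' / E g'" "t = E' f' / E' g'"
      by blast
    then have "E (f * g' - f' * g) = 0"
      using that by (simp add: E_0 E.hom_minus E.hom_mult frac_eq_eq)
    then have "f * g' = f' * g"
      by (simp add: E_0)
    then have "E' f * E' g' = E' f' * E' g"
      by (metis E'.hom_mult)
    then show "t = E' f / E' g"
      using * that by (simp add: E'_0 frac_eq_eq)
  qed (use that in blast)
  have \<phi>_E: "\<phi> (E f) = E' f" for f
    using \<phi>[of 1 f] by simp
  have \<phi>_i: "\<phi> (i a) = j a" for a
    using \<phi>_E[of "[:a:]"] by (simp add: E_def E'_def i.map_poly_pCons_hom j.map_poly_pCons_hom)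
  have \<phi>_x: "\<phi> x = y"
    using \<phi>_E[of "[:0, 1:]"] by (simp add: E_def E'_def i.map_poly_pCons_hom j.map_poly_pCons_hom)
  have hom: "field_hom \<phi>"
  proof
    show "\<phi> 0 = 0" "\<phi> 1 = 1"
      using \<phi>_E[of 0] \<phi>_E[of 1] by simp_all
  next
    fix z z'
    obtain f g f' g' where *: "g \<noteq> 0" "g' \<noteq> 0" "z = E f / E g" "z' = E f' / E g'"
      using E_cases by metis
    have "z + z' = E (f * g' + f' * g) / E (g * g')"
      using * by (simp add: E_0 E.hom_add E.hom_mult add_frac_eq)
    also have "\<phi> \<dots> = E' (f * g' + f' * g) / E' (g * g')"
      using * by (intro \<phi>) simp
    also have "\<dots> = \<phi> z + \<phi> z'"
      using * by (simp add: \<phi> E'_0 E'.hom_add E'.hom_mult add_frac_eq)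
    finally show "\<phi> (z + z') = \<phi> z + \<phi> z'" .
    have "z * z' = E (f * f') / E (g * g')"
      using * by (simp add: E.hom_mult)
    also have "\<phi> \<dots> = E' (f * f') / E' (g * g')"
      using * by (intro \<phi>) simp
    also have "\<dots> = \<phi> z * \<phi> z'"
      using * by (simp add: \<phi> E'.hom_mult)
    finally show "\<phi> (z * z') = \<phi> z * \<phi> z'" .
  qed
  then interpret phi: field_hom \<phi> .
  have "\<exists>z. t = \<phi> z" for t
  proof -
    obtain f g where "g \<noteq> 0" "t = E' f / E' g"
      using E'_cases by blast
    then have "t = \<phi> (E f / E g)"
      by (simp add: \<phi>)
    then show ?thesis ..
  qed
  then have "surj \<phi>"
    unfolding surj_def by blast
  then have "bij \<phi>"
    using phi.inj_f by (simp add: bij_def)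
  then show ?thesis
    using hom \<phi>_i \<phi>_x unfolding isomorphism_over_def by blast
qed


section \<open>The valuation on rational functions\<close>

definition fract_const :: "'k::field \<Rightarrow> 'k poly fract" where
  "fract_const a = Fract [:a:] 1"

definition fract_X :: "'k::field poly fract" where
  "fract_X = Fract [:0, 1:] 1"

lemma field_hom_fract_const: "field_hom fract_const"
  by unfold_locales (simp_all add: fract_const_def Zero_fract_def One_fract_def one_pCons mult.commute)

lemma poly_map_poly_fract_const: "poly (map_poly fract_const f) fract_X = Fract f 1"
proof -
  interpret field_hom fract_const
    by (rule field_hom_fract_const)
  show ?thesis
  proof (induction f)
    case (pCons a f)
    then have "poly (map_poly fract_const (pCons a f)) fract_X = fract_const a + fract_X * Fract f 1"
      by (simp add: map_poly_pCons_hom)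
    also have "\<dots> = Fract (pCons a f) 1"
      by (simp add: fract_const_def fract_X_def)
    finally show ?case .
  qed (simp add: Zero_fract_def)
qed

lemma simple_extension_fract: "simple_extension (fract_const :: 'k::field \<Rightarrow> _) fract_X"
proof -
  interpret field_hom "fract_const :: 'k \<Rightarrow> _"
    by (rule field_hom_fract_const)
  have add: "a + b \<in> adjoin fract_const fract_X"
    if "a \<in> adjoin fract_const fract_X" "b \<in> adjoin fract_const fract_X" for a b :: "'k poly fract"
    using adjoin.diff[OF that(1) adjoin.diff[OF adjoin.base[of fract_const 0] that(2)]] by simp
  have "poly (map_poly fract_const f) fract_X \<in> adjoin fract_const fract_X" for f :: "'k poly"
  proof (induction f)
    case 0
    then show ?case
      using adjoin.base[of "fract_const :: 'k \<Rightarrow> _" 0 fract_X] by simp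
  next
    case (pCons a f)
    then show ?case
      by (auto simp: map_poly_pCons_hom intro!: add adjoin.intros)
  qed
  then have poly: "Fract f 1 \<in> adjoin fract_const fract_X" for f :: "'k poly"
    by (simp add: poly_map_poly_fract_const)
  have "q \<in> adjoin fract_const fract_X" for q :: "'k poly fract"
  proof (cases q)
    case (Fract f g)
    have "Fract f 1 * inverse (Fract g 1) \<in> adjoin fract_const fract_X"
      by (intro adjoin.mult adjoin.inverse poly)
    then show ?thesis
      using Fract by simp
  qed
  then show ?thesis
    by (auto simp: simple_extension_def)
qed

context transcendental_filter
begin

text \<open>
  The filter avoids every single point \<open>a\<close>, because \<open>d - a\<close> eventually has a leading term, and
  therefore every finite set of roots.
\<close>

lemma eventually_poly_nonzero:
  assumes "f \<noteq> 0"
  shows "\<forall>\<^sub>F d in F. poly f d \<noteq> 0"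
proof -
  have "\<forall>\<^sub>F d in F. d \<noteq> a" for a
  proof -
    obtain r where "\<forall>\<^sub>F d in F. same_leading_term v r (d - a)"
      using leading_term_diff by blast
    then show ?thesis
      by eventually_elim (use same_leading_term_nonzero(2)[OF v] in fastforce)
  qed
  then have "\<forall>\<^sub>F d in F. \<forall>a\<in>{a. poly f a = 0}. d \<noteq> a"
    using poly_roots_finite[OF assms] by (intro eventually_ball_finite) auto
  then show ?thesis
    by eventually_elim auto
qed

text \<open>
  Quantifying over all representations of \<open>q\<close> as a fraction avoids normal forms; by
  \<open>limit_value_eqI\<close> any one of them computes the value.
\<close>

definition limit_value :: "'k poly fract \<Rightarrow> 'g extended" where
  "limit_value q =
     (THE \<alpha>. \<exists>f g. g \<noteq> 0 \<and> q = Fract f g \<and> (\<forall>\<^sub>F d in F. v (poly f d / poly g d) = \<alpha>))"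

lemma limit_value_eqI:
  assumes "g \<noteq> 0" "\<forall>\<^sub>F d in F. v (poly f d / poly g d) = \<alpha>"
  shows "limit_value (Fract f g) = \<alpha>"
  unfolding limit_value_def
proof (rule the_equality)
  fix \<beta> assume "\<exists>f' g'. g' \<noteq> 0 \<and> Fract f g = Fract f' g' \<and> (\<forall>\<^sub>F d in F. v (poly f' d / poly g' d) = \<beta>)"
  then obtain f' g' where *: "g' \<noteq> 0" "Fract f g = Fract f' g'"
    "\<forall>\<^sub>F d in F. v (poly f' d / poly g' d) = \<beta>"
    by blast
  then have eq: "f * g' = f' * g"
    using assms(1) by (simp add: eq_fract)
  have "\<forall>\<^sub>F d in F. \<beta> = \<alpha>"
    using assms(2) *(3) eventually_poly_nonzero[OF assms(1)] eventually_poly_nonzero[OF *(1)]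
  proof eventually_elim
    case (elim d)
    moreover have "poly f d * poly g' d = poly f' d * poly g d"
      using arg_cong[OF eq, of "\<lambda>p. poly p d"] by simp
    ultimately have "poly f d / poly g d = poly f' d / poly g' d"
      by (simp add: frac_eq_eq)
    then show ?case
      using elim by simp
  qed
  then show "\<beta> = \<alpha>"
    using F by (simp add: eventually_const)
qed (use assms in blast)

lemma eventually_limit_value:
  assumes "g \<noteq> 0"
  shows "\<forall>\<^sub>F d in F. v (poly f d / poly g d) = limit_value (Fract f g)"
proof -
  obtain \<alpha> \<beta> where "\<forall>\<^sub>F d in F. v (poly f d) = \<alpha>" "\<forall>\<^sub>F d in F. v (poly g d) = \<beta>"
    using poly_value by metis
  with eventually_poly_nonzero[OF assms] have *: "\<forall>\<^sub>F d in F. v (poly f d / poly g d) = \<alpha> - \<beta>"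
    by eventually_elim (simp add: valuation_divide[OF v])
  then show ?thesis
    using limit_value_eqI[OF assms *] by simp
qed

lemma eventually_limit_value_poly: "\<forall>\<^sub>F d in F. v (poly f d) = limit_value (Fract f 1)"
  using eventually_limit_value[of 1 f] by simp

lemma limit_value_const: "limit_value (fract_const a) = v a"
  unfolding fract_const_def by (rule limit_value_eqI) simp_all

lemma eventually_limit_value_diff:
  "\<forall>\<^sub>F d in F. v (d - c) = limit_value (fract_X - fract_const c)"
  using eventually_limit_value_poly[of "[:- c, 1:]"] by (simp add: fract_X_def fract_const_def)

lemma valuation_limit_value: "valuation limit_value"
  unfolding valuation_def
proof (intro conjI allI)
  fix q q' :: "'k poly fract"
  obtain f g where q: "q = Fract f g" "g \<noteq> 0"
    by (cases q)
  obtain f' g' where q': "q' = Fract f' g'" "g' \<noteq> 0"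
    by (cases q')
  note ev = eventually_limit_value[OF q(2), of f, folded q(1)]
  note ev' = eventually_limit_value[OF q'(2), of f', folded q'(1)]
  obtain d where "v (poly f d / poly g d) = limit_value q"
    using eventually_happens'[OF F ev] by blast
  then show "limit_value q \<noteq> Minf"
    using v unfolding valuation_def by metis
  show "limit_value q = Pinf \<longleftrightarrow> q = 0"
  proof
    assume "q = 0"
    then show "limit_value q = Pinf"
      using limit_value_const[of 0] valuation_zero[OF v]
      by (simp add: fract_const_def Zero_fract_def)
  next
    assume inf: "limit_value q = Pinf"
    show "q = 0"
    proof (rule ccontr)
      assume "q \<noteq> 0"
      then have "f \<noteq> 0"
        using q by (auto simp: fract_collapse)
      from ev eventually_poly_nonzero[OF this] eventually_poly_nonzero[OF q(2)]
      have "\<forall>\<^sub>F d in F. False"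
        by eventually_elim (simp add: inf valuation_eq_Pinf_iff[OF v])
      then show False
        using F by (simp add: eventually_const)
    qed
  qed
  have "\<forall>\<^sub>F d in F. v (poly (f * f') d / poly (g * g') d) = limit_value q + limit_value q'"
    using ev ev'
  proof eventually_elim
    case (elim d)
    then show ?case
      using valuation_mult[OF v, of "poly f d / poly g d" "poly f' d / poly g' d"] by simp
  qed
  then show "limit_value (q * q') = limit_value q + limit_value q'"
    using q q' limit_value_eqI[of "g * g'" "f * f'"] by simp
  have "g * g' \<noteq> 0"
    using q q' by simp
  from ev ev' eventually_limit_value[OF this, of "f * g' + f' * g"]
    eventually_poly_nonzero[OF q(2)] eventually_poly_nonzero[OF q'(2)]
  have "\<forall>\<^sub>F d in F. min (limit_value q) (limit_value q') \<le> limit_value (q + q')"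
  proof eventually_elim
    case (elim d)
    then have "poly f d / poly g d + poly f' d / poly g' d =
        poly (f * g' + f' * g) d / poly (g * g') d"
      by (simp add: add_frac_eq)
    then show ?case
      using valuation_add_ge_min[OF v, of "poly f d / poly g d" "poly f' d / poly g' d"] elim q q'
      by simp
  qed
  then show "min (limit_value q) (limit_value q') \<le> limit_value (q + q')"
    using F by (simp add: eventually_const)
qed

lemma valued_field_extension_limit_value: "valued_field_extension v limit_value fract_const"
  using v valuation_limit_value field_hom_fract_const
  by (auto simp: valued_field_extension_def equivalent_valuations_def valuation_ring_def
      limit_value_const)

lemma limit_point_fract_X: "limit_point limit_value fract_const fract_X"
  unfolding limit_point_def
proof
  interpret C: field_hom fract_const
    by (rule field_hom_fract_const)
  fix a
  obtain r where r: "\<forall>\<^sub>F d in F. same_leading_term v r (d - a)"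
    using leading_term_diff by blast
  from r eventually_limit_value_diff[of "a + r"]
  have "\<forall>\<^sub>F d in F. v r < limit_value (fract_X - fract_const (a + r))"
    by eventually_elim (simp add: same_leading_term_def algebra_simps)
  then have "same_leading_term limit_value (fract_const r) (fract_X - fract_const a)"
    using F by (simp add: eventually_const same_leading_term_def limit_value_const C.hom_add
        diff_diff_eq)
  with r show "\<exists>r. (\<forall>\<^sub>F d in F. same_leading_term v r (d - a)) \<and>
      same_leading_term limit_value (fract_const r) (fract_X - fract_const a)"
    by blast
qed

lemma immediate_extension_limit_value: "immediate_extension v limit_value fract_const"
proof (rule immediate_extension_if_leading_terms[OF valued_field_extension_limit_value])
  interpret C: field_hom fract_const
    by (rule field_hom_fract_const)
  have poly: "\<exists>r. same_leading_term limit_value (fract_const r) (Fract f 1)" if "f \<noteq> 0" for f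
    using ex_leading_term_poly[OF valued_field_extension_limit_value limit_point_fract_X that]
    by (auto simp: poly_map_poly_fract_const)
  fix q :: "'k poly fract" assume "q \<noteq> 0"
  then obtain f g where q: "q = Fract f g" "f \<noteq> 0" "g \<noteq> 0"
    by (cases q rule: Fract_cases_nonzero) auto
  obtain r s where "same_leading_term limit_value (fract_const r) (Fract f 1)"
    "same_leading_term limit_value (fract_const s) (Fract g 1)"
    using poly q by blast
  then have "same_leading_term limit_value (fract_const r / fract_const s) (Fract f 1 / Fract g 1)"
    by (rule same_leading_term_divide[OF valuation_limit_value])
  then show "\<exists>r. same_leading_term limit_value (fract_const r) q"
    using q by (auto simp flip: C.hom_div)
qed

end


section \<open>The filter of balls of an immediate approximation type\<close>

text \<open>
  Being eventually true along this filter means being true on some ball of \<open>A\<close>. As the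
  balls form a chain, finitely many eventual properties hold at a common point.
\<close>

definition ball_filter :: "('k, 'g) ball set \<Rightarrow> 'k filter" where
  "ball_filter A = (INF B\<in>A. principal (points B))"

context
  fixes v :: "'k::field \<Rightarrow> 'g::linordered_ab_group_add extended" and A :: "('k, 'g) ball set"
  assumes v: "valuation v" and A: "immediate_approximation_type v A"
begin

lemma eventually_ball_filter:
  "eventually P (ball_filter A) \<longleftrightarrow> (\<exists>B\<in>A. \<forall>d\<in>points B. P d)"
  unfolding ball_filter_def
proof (subst eventually_INF_base)
  show "A \<noteq> {}"
    using A by (simp add: immediate_approximation_type_def)
next
  fix B C assume "B \<in> A" "C \<in> A"
  then have "points B \<subseteq> points C \<or> points C \<subseteq> points B"
    using A by (auto simp: immediate_approximation_type_def approximation_type_def)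
  then show "\<exists>D\<in>A. principal (points D) \<le> inf (principal (points B)) (principal (points C))"
    using \<open>B \<in> A\<close> \<open>C \<in> A\<close> by auto
qed (simp add: eventually_principal)

lemma ball_cases:
  assumes "B \<in> A"
  obtains (closed) \<beta> b where "\<beta> \<in> insert Pinf (value_group v)" "B = closed_ball v \<beta> b"
  | (opened) \<beta> b where "\<beta> \<in> value_group v" "B = open_ball v \<beta> b"
  using assms A unfolding immediate_approximation_type_def approximation_type_def balls_def by blast

lemma value_group_less_Pinf: "\<gamma> \<in> value_group v \<Longrightarrow> \<gamma> < Pinf"
  using valuation_eq_Pinf_iff[OF v] by (auto simp: value_group_def less_le)

lemma points_nonempty:
  assumes "B \<in> A"
  shows "points B \<noteq> {}"
  using assms
proof (cases rule: ball_cases)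
  case (closed \<beta> b)
  then have "b \<in> points B"
    by (simp add: closed_ball_def valuation_zero[OF v])
  then show ?thesis by blast
next
  case (opened \<beta> b)
  then have "b \<in> points B"
    using value_group_less_Pinf by (simp add: open_ball_def valuation_zero[OF v])
  then show ?thesis by blast
qed

lemma ball_filter_neq_bot: "ball_filter A \<noteq> bot"
  using points_nonempty by (auto simp: trivial_limit_def eventually_ball_filter)

lemma ex_ball_notin: "\<exists>B\<in>A. a \<notin> points B"
  using A by (auto simp: immediate_approximation_type_def)

lemma closed_ball_eq:
  assumes "\<gamma> \<le> v (b - c)"
  shows "closed_ball v \<gamma> b = closed_ball v \<gamma> c"
proof -
  have "\<gamma> \<le> v (a - b) \<longleftrightarrow> \<gamma> \<le> v (a - c)" for a
    using valuation_add_ge[OF v, of \<gamma> "a - b" "b - c"]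
      valuation_diff_ge[OF v, of \<gamma> "a - c" "b - c"] assms by auto
  then show ?thesis
    by (simp add: closed_ball_def)
qed

lemma open_ball_eq:
  assumes "\<gamma> < v (b - c)"
  shows "open_ball v \<gamma> b = open_ball v \<gamma> c"
proof -
  have "\<gamma> < v (a - b) \<longleftrightarrow> \<gamma> < v (a - c)" for a
    using valuation_add_greater[OF v, of \<gamma> "a - b" "b - c"]
      valuation_diff_greater[OF v, of \<gamma> "a - c" "b - c"] assms by auto
  then show ?thesis
    by (simp add: open_ball_def)
qed

text \<open>
  Comparable balls of the same kind and radius coincide, so that \<open>closed_at\<close> is determined.
\<close>

lemma points_closed_at:
  assumes "\<delta> \<in> supp A"
  shows "Ball Closed \<delta> (closed_at A \<delta>) \<in> A"
proof -
  have closed: "\<exists>c. C = closed_ball v \<delta> c" if "C \<in> A" "kind C = Closed" "radius C = \<delta>" for C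
    using that(1)
  proof (cases rule: ball_cases)
    case (closed \<beta> b)
    then show ?thesis
      using that by (auto simp: closed_ball_def)
  next
    case (opened \<beta> b)
    then show ?thesis
      using that by (auto simp: open_ball_def)
  qed
  obtain B where B: "B \<in> A" "kind B = Closed" "radius B = \<delta>"
    using assms by (auto simp: supp_def)
  have unique: "C = B" if C: "C \<in> A" "kind C = Closed" "radius C = \<delta>" for C
  proof -
    obtain b c where bc: "B = closed_ball v \<delta> b" "C = closed_ball v \<delta> c"
      using closed[OF B] closed[OF C] by blast
    have "points B \<subseteq> points C \<or> points C \<subseteq> points B"
      using A B(1) C(1) by (auto simp: immediate_approximation_type_def approximation_type_def)
    moreover have "b \<in> points B" "c \<in> points C"
      unfolding bc by (simp_all add: closed_ball_def valuation_zero[OF v])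
    ultimately have "b \<in> points C \<or> c \<in> points B"
      by blast
    then have "\<delta> \<le> v (b - c)"
      unfolding bc using valuation_minus_commute[OF v, of b c] by (auto simp: closed_ball_def)
    then show ?thesis
      unfolding bc by (rule closed_ball_eq[symmetric])
  qed
  have "Ball Closed \<delta> (points B) \<in> A"
    using B by (cases B) simp
  then show ?thesis
    unfolding closed_at_def
    by (rule theI) (use unique in \<open>metis ball.sel\<close>)
qed

text \<open>
  Take a ball of \<open>A\<close> that misses \<open>a\<close>: its center \<open>b\<close> is closer to all of its points than to \<open>a\<close>,
  so \<open>b - a\<close> is a leading term of \<open>d - a\<close> for all of them.
\<close>

lemma ex_leading_term_diff:
  "\<exists>r. \<forall>\<^sub>F d in ball_filter A. same_leading_term v r (d - a)"
proof -
  obtain B where B: "B \<in> A" "a \<notin> points B"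
    using ex_ball_notin by blast
  have "\<exists>b. \<forall>d\<in>points B. v (b - a) < v (d - b)"
    using B(1)
  proof (cases rule: ball_cases)
    case (closed \<beta> b)
    then have "v (b - a) < \<beta>"
      using B(2) valuation_minus_commute[OF v, of b a] by (simp add: closed_ball_def)
    then show ?thesis
      using closed by (auto simp: closed_ball_def intro!: exI[of _ b])
  next
    case (opened \<beta> b)
    then have "v (b - a) \<le> \<beta>"
      using B(2) valuation_minus_commute[OF v, of b a] by (simp add: open_ball_def)
    then show ?thesis
      using opened by (auto simp: open_ball_def intro!: exI[of _ b])
  qed
  then obtain b where "\<forall>d\<in>points B. v (b - a) < v (d - b)"
    by blast
  then show ?thesis
    using B(1) by (intro exI[of _ "b - a"]) (auto simp: eventually_ball_filter same_leading_term_def)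
qed

lemma smaller_ball:
  assumes "closed_ball v \<beta> b \<in> A \<or> open_ball v \<beta> b \<in> A" "\<gamma> \<in> value_group v" "\<gamma> < \<beta>"
  shows "closed_ball v \<gamma> b \<in> A" "open_ball v \<gamma> b \<in> A"
  using assms A unfolding immediate_approximation_type_def approximation_type_def by blast+

lemma closed_ball_if_open_ball: "open_ball v \<beta> b \<in> A \<Longrightarrow> closed_ball v \<beta> b \<in> A"
  using A unfolding immediate_approximation_type_def approximation_type_def by blast

text \<open>
  An approximation type is downward closed in the radius only; emptiness of the intersection turns
  this into a converse. If the points \<open>d\<close> are eventually in the ball around \<open>c\<close>, compare it with
  a ball of \<open>A\<close> that misses \<open>c\<close>: a common point shows that the latter has the larger radius, up to the
  borderline case of an open ball of equal radius, so moving \<open>c\<close> to its center exhibits the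
  ball around \<open>c\<close> as a member of \<open>A\<close>.
\<close>

lemma eventually_closed_ball_iff:
  assumes \<gamma>: "\<gamma> \<in> insert Pinf (value_group v)"
  shows "closed_ball v \<gamma> c \<in> A \<longleftrightarrow> (\<forall>\<^sub>F d in ball_filter A. \<gamma> \<le> v (d - c))"
proof
  assume "closed_ball v \<gamma> c \<in> A"
  then show "\<forall>\<^sub>F d in ball_filter A. \<gamma> \<le> v (d - c)"
    unfolding eventually_ball_filter by (intro bexI) (auto simp: closed_ball_def)
next
  assume ev: "\<forall>\<^sub>F d in ball_filter A. \<gamma> \<le> v (d - c)"
  obtain B where B: "B \<in> A" "c \<notin> points B"
    using ex_ball_notin by blast
  have "\<forall>\<^sub>F d in ball_filter A. d \<in> points B"
    using B(1) by (auto simp: eventually_ball_filter)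
  then obtain d where d: "d \<in> points B" "\<gamma> \<le> v (d - c)"
    using eventually_happens'[OF ball_filter_neq_bot eventually_conj[OF _ ev]] by blast
  have down: "closed_ball v \<gamma> b \<in> A" if "closed_ball v \<beta> b \<in> A" "\<gamma> \<le> \<beta>" "\<gamma> < Pinf" for \<beta> b
    using that \<gamma> smaller_ball(1)[of \<beta> b \<gamma>] by (cases "\<gamma> = \<beta>") auto
  show "closed_ball v \<gamma> c \<in> A"
    using B(1)
  proof (cases rule: ball_cases)
    case (closed \<beta> b)
    then have *: "v (b - c) < \<beta>" "\<beta> \<le> v (d - b)"
      using B(2) d(1) valuation_minus_commute[OF v, of b c] by (simp_all add: closed_ball_def)
    then have "v (d - c) = v (b - c)"
      using valuation_add_eq[OF v, of "b - c" "d - b"] by simp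
    then have "\<gamma> \<le> v (b - c)" "\<gamma> < \<beta>"
      using * d(2) by auto
    then show ?thesis
      using down[of \<beta> b] closed B(1) closed_ball_eq[of \<gamma> b c] less_le_trans[OF \<open>\<gamma> < \<beta>\<close> le_Pinf]
      by auto
  next
    case (opened \<beta> b)
    then have *: "v (b - c) \<le> \<beta>" "\<beta> < v (d - b)"
      using B(2) d(1) valuation_minus_commute[OF v, of b c] by (simp_all add: open_ball_def)
    then have "v (d - c) = v (b - c)"
      using valuation_add_eq[OF v, of "b - c" "d - b"] by simp
    then have "\<gamma> \<le> v (b - c)" "\<gamma> \<le> \<beta>"
      using * d(2) by auto
    moreover have "closed_ball v \<beta> b \<in> A"
      using B(1) opened closed_ball_if_open_ball by simp
    ultimately show ?thesis
      using down[of \<beta> b] closed_ball_eq[of \<gamma> b c] value_group_less_Pinf[OF opened(1)] by auto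
  qed
qed

lemma eventually_open_ball_iff:
  assumes \<gamma>: "\<gamma> \<in> value_group v"
  shows "open_ball v \<gamma> c \<in> A \<longleftrightarrow> (\<forall>\<^sub>F d in ball_filter A. \<gamma> < v (d - c))"
proof
  assume "open_ball v \<gamma> c \<in> A"
  then show "\<forall>\<^sub>F d in ball_filter A. \<gamma> < v (d - c)"
    unfolding eventually_ball_filter by (intro bexI) (auto simp: open_ball_def)
next
  assume ev: "\<forall>\<^sub>F d in ball_filter A. \<gamma> < v (d - c)"
  obtain B where B: "B \<in> A" "c \<notin> points B"
    using ex_ball_notin by blast
  have "\<forall>\<^sub>F d in ball_filter A. d \<in> points B"
    using B(1) by (auto simp: eventually_ball_filter)
  then obtain d where d: "d \<in> points B" "\<gamma> < v (d - c)"
    using eventually_happens'[OF ball_filter_neq_bot eventually_conj[OF _ ev]] by blast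
  show "open_ball v \<gamma> c \<in> A"
    using B(1)
  proof (cases rule: ball_cases)
    case (closed \<beta> b)
    then have *: "v (b - c) < \<beta>" "\<beta> \<le> v (d - b)"
      using B(2) d(1) valuation_minus_commute[OF v, of b c] by (simp_all add: closed_ball_def)
    then have "v (d - c) = v (b - c)"
      using valuation_add_eq[OF v, of "b - c" "d - b"] by simp
    then have **: "\<gamma> < v (b - c)" "\<gamma> < \<beta>"
      using * d(2) by auto
    then have "open_ball v \<gamma> b \<in> A"
      using B(1) closed \<gamma> smaller_ball(2)[of \<beta> b \<gamma>] by simp
    then show ?thesis
      using open_ball_eq ** by simp
  next
    case (opened \<beta> b)
    then have *: "v (b - c) \<le> \<beta>" "\<beta> < v (d - b)"
      using B(2) d(1) valuation_minus_commute[OF v, of b c] by (simp_all add: open_ball_def)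
    then have "v (d - c) = v (b - c)"
      using valuation_add_eq[OF v, of "b - c" "d - b"] by simp
    then have **: "\<gamma> < v (b - c)" "\<gamma> < \<beta>"
      using * d(2) by auto
    then have "open_ball v \<gamma> b \<in> A"
      using B(1) opened \<gamma> smaller_ball(2)[of \<beta> b \<gamma>] by simp
    then show ?thesis
      using open_ball_eq ** by simp
  qed
qed

text \<open>
  Rewrites a ball of \<open>A\<close> into the form in which \<open>appr\<close> records it, as a set of admissible centers.
\<close>

lemma closed_ball_eq_centers:
  assumes "closed_ball v \<gamma> c \<in> A" "\<gamma> \<in> insert Pinf (value_group v)"
  shows "closed_ball v \<gamma> c = Ball Closed \<gamma> {a. closed_ball v \<gamma> a \<in> A}"
proof -
  have "closed_ball v \<gamma> a \<in> A \<longleftrightarrow> \<gamma> \<le> v (a - c)" for a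
  proof
    assume a: "closed_ball v \<gamma> a \<in> A"
    obtain d where "\<gamma> \<le> v (d - c)" "\<gamma> \<le> v (d - a)"
      using assms a eventually_closed_ball_iff
        eventually_happens'[OF ball_filter_neq_bot eventually_conj] by metis
    then show "\<gamma> \<le> v (a - c)"
      using valuation_diff_ge[OF v, of \<gamma> "d - c" "d - a"] by simp
  qed (use assms closed_ball_eq in simp)
  then show ?thesis
    by (simp add: closed_ball_def)
qed

lemma open_ball_eq_centers:
  assumes "open_ball v \<gamma> c \<in> A" "\<gamma> \<in> value_group v"
  shows "open_ball v \<gamma> c = Ball Open \<gamma> {a. open_ball v \<gamma> a \<in> A}"
proof -
  have "open_ball v \<gamma> a \<in> A \<longleftrightarrow> \<gamma> < v (a - c)" for a
  proof
    assume a: "open_ball v \<gamma> a \<in> A"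
    obtain d where "\<gamma> < v (d - c)" "\<gamma> < v (d - a)"
      using assms a eventually_open_ball_iff
        eventually_happens'[OF ball_filter_neq_bot eventually_conj] by metis
    then show "\<gamma> < v (a - c)"
      using valuation_diff_greater[OF v, of \<gamma> "d - c" "d - a"] by simp
  qed (use assms open_ball_eq in simp)
  then show ?thesis
    by (simp add: open_ball_def)
qed

lemma appr_eqI:
  assumes closed: "\<And>\<gamma> c. \<gamma> \<in> insert Pinf (value_group v) \<Longrightarrow>
      value_embedding v w i \<gamma> \<le> w (x - i c) \<longleftrightarrow> closed_ball v \<gamma> c \<in> A"
    and opened: "\<And>\<gamma> c. \<gamma> \<in> value_group v \<Longrightarrow>
      value_embedding v w i \<gamma> < w (x - i c) \<longleftrightarrow> open_ball v \<gamma> c \<in> A"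
  shows "appr v w i x = A"
proof -
  have "appr v w i x =
     {Ball Closed \<gamma> S | \<gamma> S. \<gamma> \<in> insert Pinf (value_group v) \<and>
        S = {c. closed_ball v \<gamma> c \<in> A} \<and> S \<noteq> {}} \<union>
     {Ball Open \<gamma> S | \<gamma> S. \<gamma> \<in> value_group v \<and> S = {c. open_ball v \<gamma> c \<in> A} \<and> S \<noteq> {}}"
    unfolding appr_def
    by (intro arg_cong2[where f = "(\<union>)"] Collect_cong ex_cong1 conj_cong refl)
      (simp_all add: closed opened)
  also have "\<dots> = A"
  proof (intro equalityI subsetI)
    fix B assume "B \<in> A"
    then show "B \<in> {Ball Closed \<gamma> S | \<gamma> S. \<gamma> \<in> insert Pinf (value_group v) \<and>
        S = {c. closed_ball v \<gamma> c \<in> A} \<and> S \<noteq> {}} \<union>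
      {Ball Open \<gamma> S | \<gamma> S. \<gamma> \<in> value_group v \<and> S = {c. open_ball v \<gamma> c \<in> A} \<and> S \<noteq> {}}"
      (is "_ \<in> ?C \<union> ?O")
    proof (cases rule: ball_cases)
      case (closed \<beta> b)
      then have "B = Ball Closed \<beta> {c. closed_ball v \<beta> c \<in> A}" "{c. closed_ball v \<beta> c \<in> A} \<noteq> {}"
        using \<open>B \<in> A\<close> closed_ball_eq_centers by auto
      then have "B \<in> ?C"
        using closed(1) by blast
      then show ?thesis ..
    next
      case (opened \<beta> b)
      then have "B = Ball Open \<beta> {c. open_ball v \<beta> c \<in> A}" "{c. open_ball v \<beta> c \<in> A} \<noteq> {}"
        using \<open>B \<in> A\<close> open_ball_eq_centers by auto
      then have "B \<in> ?O"
        using opened(1) by blast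
      then show ?thesis ..
    qed
  qed (use closed_ball_eq_centers open_ball_eq_centers in fastforce)
  finally show ?thesis .
qed

end

lemma transcendental_filter_ball_filter:
  assumes v: "valuation v" and A: "transcendental_immediate_approximation_type v A"
  shows "transcendental_filter v (ball_filter A)"
proof
  have imm: "immediate_approximation_type v A"
    using A by (simp add: transcendental_immediate_approximation_type_def)
  show "valuation v" by fact
  show "ball_filter A \<noteq> bot"
    by (rule ball_filter_neq_bot[OF v imm])
  show "\<exists>r. \<forall>\<^sub>F d in ball_filter A. same_leading_term v r (d - a)" for a
    by (rule ex_leading_term_diff[OF v imm])
  fix f :: "'a poly"
  obtain \<delta> \<alpha> where "\<delta> \<in> supp A" and const: "\<forall>c\<in>closed_at A \<delta>. v (poly f c) = \<alpha>"
    using A unfolding transcendental_immediate_approximation_type_def by blast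
  from points_closed_at[OF v imm this(1)] const
  show "\<exists>\<alpha>. \<forall>\<^sub>F d in ball_filter A. v (poly f d) = \<alpha>"
    unfolding eventually_ball_filter[OF v imm] by (intro exI[of _ \<alpha>] bexI) auto
qed

lemma appr_limit_value:
  assumes v: "valuation v" and A: "transcendental_immediate_approximation_type v A"
  shows "appr v (transcendental_filter.limit_value v (ball_filter A)) fract_const fract_X = A"
proof -
  have imm: "immediate_approximation_type v A"
    using A by (simp add: transcendental_immediate_approximation_type_def)
  interpret transcendental_filter v "ball_filter A"
    using v A by (rule transcendental_filter_ball_filter)
  have emb: "value_embedding v limit_value fract_const \<gamma> = \<gamma>"
    if "\<gamma> \<in> insert Pinf (value_group v)" for \<gamma>
  proof -
    have "\<exists>a. \<gamma> = v a"
    proof (cases "\<gamma> = Pinf")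
      case True
      then show ?thesis
        using valuation_zero[OF v] by metis
    next
      case False
      then show ?thesis
        using that by (auto simp: value_group_def)
    qed
    then show ?thesis
      using value_embedding_value[OF valued_field_extension_limit_value]
      by (auto simp: limit_value_const)
  qed
  have const: "(\<forall>\<^sub>F d in ball_filter A. P (v (d - c))) \<longleftrightarrow> P (limit_value (fract_X - fract_const c))"
    for P c
  proof -
    have "(\<forall>\<^sub>F d in ball_filter A. P (v (d - c))) \<longleftrightarrow>
        (\<forall>\<^sub>F d in ball_filter A. P (limit_value (fract_X - fract_const c)))"
      by (rule eventually_subst[OF eventually_mono[OF eventually_limit_value_diff[of c]]]) simp
    then show ?thesis
      using F by (simp add: eventually_const)
  qed
  show ?thesis
    by (rule appr_eqI[OF v imm])
      (simp_all add: emb const eventually_closed_ball_iff[OF v imm] eventually_open_ball_iff[OF v imm])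
qed

text \<open>
  The balls of \<open>appr\<close> are given by lower bounds for \<open>u (y - j d)\<close>. Hence if such a ball misses \<open>a\<close>, all
  of its points are closer to \<open>y\<close> than \<open>a\<close> is, and therefore closer to each other than to \<open>a\<close>.
\<close>

lemma limit_point_if_appr:
  assumes A: "transcendental_immediate_approximation_type v A"
    and ext: "valued_field_extension v u j" and y: "appr v u j y = A"
  shows "transcendental_filter.limit_point v (ball_filter A) u j y"
proof -
  have v: "valuation v" and u: "valuation u"
    using ext by (auto simp: valued_field_extension_def)
  have imm: "immediate_approximation_type v A"
    using A by (simp add: transcendental_immediate_approximation_type_def)
  interpret transcendental_filter v "ball_filter A"
    using v A by (rule transcendental_filter_ball_filter)
  interpret j: field_hom j
    using ext by (simp add: valued_field_extension_def)
  show ?thesis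
    unfolding limit_point_def
  proof
    fix a
    obtain B where B: "B \<in> A" "a \<notin> points B"
      using ex_ball_notin[OF v imm] by blast
    then have closer: "u (y - j a) < u (y - j d)" if "d \<in> points B" for d
      using that unfolding y[symmetric] appr_def by auto
    obtain b where b: "b \<in> points B"
      using points_nonempty[OF v imm B(1)] by blast
    have "u (j (b - a)) = u (y - j a)"
      using valuation_add_eq[OF u, of "y - j a" "j b - y"] closer[OF b]
        valuation_minus_commute[OF u, of "j b" y]
      by (simp add: j.hom_minus)
    moreover have "same_leading_term v (b - a) (d - a)" if "d \<in> points B" for d
    proof -
      have "u (y - j a) < u (j (d - b))"
        using valuation_diff_greater[OF u closer[OF b] closer[OF that]] by (simp add: j.hom_minus)
      then have "u (j (b - a)) < u (j (d - b))"
        using calculation by simp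
      then show ?thesis
        using valued_field_extension_less_iff[OF ext] by (simp add: same_leading_term_def)
    qed
    ultimately show "\<exists>r. (\<forall>\<^sub>F d in ball_filter A. same_leading_term v r (d - a)) \<and>
        same_leading_term u (j r) (y - j a)"
      using B(1) closer[OF b]
      by (intro exI[of _ "b - a"])
        (auto simp: eventually_ball_filter[OF v imm] same_leading_term_def j.hom_minus)
  qed
qed

lemma valuation_preserving_limit_points:
  assumes "transcendental_filter v F"
    and w: "valued_field_extension v w i" "transcendental_filter.limit_point v F w i x"
    and u: "valued_field_extension v u j" "transcendental_filter.limit_point v F u j y"
    and simple: "simple_extension i x" and \<phi>: "isomorphism_over i j \<phi>" "\<phi> x = y"
  shows "valuation_preserving w u \<phi>"
proof -
  interpret transcendental_filter v F by fact
  interpret i: field_hom i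
    using w by (simp add: valued_field_extension_def)
  interpret j: field_hom j
    using u by (simp add: valued_field_extension_def)
  interpret phi: field_hom \<phi>
    using \<phi> by (simp add: isomorphism_over_def)
  have vw: "valuation w" and vu: "valuation u"
    using w u by (auto simp: valued_field_extension_def)
  have "0 \<le> w z \<longleftrightarrow> 0 \<le> u (\<phi> z)" for z
  proof -
    have "z \<in> adjoin i x"
      using simple by (simp add: simple_extension_def)
    then obtain f g where g: "g \<noteq> 0" and z: "z = poly (map_poly i f) x / poly (map_poly i g) x"
      by (rule adjoin_transcendental_cases[OF i.field_hom_axioms transcendental_limit_point[OF w]])
    have \<phi>z: "\<phi> z = poly (map_poly j f) y / poly (map_poly j g) y"
      unfolding z phi.hom_div
      by (simp add: hom_poly_map_poly[OF i.field_hom_axioms j.field_hom_axioms \<phi>(1)] \<phi>(2))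
    show ?thesis
    proof (cases "f = 0")
      case True
      then show ?thesis
        by (simp add: z valuation_zero[OF vw] valuation_zero[OF vu])
    next
      case False
      have "0 \<le> w z \<longleftrightarrow> w (poly (map_poly i g) x) \<le> w (poly (map_poly i f) x)"
        unfolding z by (rule valuation_divide_nonneg_iff[OF vw poly_limit_point_nonzero[OF w g]])
      also have "\<dots> \<longleftrightarrow> u (poly (map_poly j g) y) \<le> u (poly (map_poly j f) y)"
        by (simp only: poly_limit_point_le_iff[OF w g False] poly_limit_point_le_iff[OF u g False])
      also have "\<dots> \<longleftrightarrow> 0 \<le> u (\<phi> z)"
        unfolding \<phi>z by (rule valuation_divide_nonneg_iff[OF vu poly_limit_point_nonzero[OF u g], symmetric])
      finally show ?thesis .
    qed
  qed
  then show ?thesis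
    by (simp add: valuation_preserving_def equivalent_valuations_def valuation_ring_def)
qed

theorem theorem3p13:
  fixes v :: "'k::field \<Rightarrow> 'g::linordered_ab_group_add extended"
    and A :: "('k, 'g) ball set"
  assumes "valuation v"
    and "transcendental_immediate_approximation_type v A"
  shows
    "(\<exists>(w :: 'k poly fract \<Rightarrow> 'g extended) (i :: 'k \<Rightarrow> 'k poly fract) x.
        immediate_extension v w i \<and> simple_extension i x \<and> transcendental_over i x \<and>
        appr v w i x = A) \<and>
     (\<forall>(w :: 'l::field \<Rightarrow> 'h::linordered_ab_group_add extended) (i :: 'k \<Rightarrow> 'l) x
        (u :: 'm::field \<Rightarrow> 'n::linordered_ab_group_add extended) (j :: 'k \<Rightarrow> 'm) y.
        immediate_extension v w i \<and> simple_extension i x \<and> transcendental_over i x \<and>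
        appr v w i x = A \<and>
        valued_field_extension v u j \<and> simple_extension j y \<and> appr v u j y = A \<longrightarrow>
        transcendental_over j y \<and>
        (\<exists>!\<phi>. isomorphism_over i j \<phi> \<and> \<phi> x = y) \<and>
        (\<forall>\<phi>. isomorphism_over i j \<phi> \<and> \<phi> x = y \<longrightarrow> valuation_preserving w u \<phi>))"
proof (intro conjI allI impI)
  interpret transcendental_filter v "ball_filter A"
    using assms by (rule transcendental_filter_ball_filter)
  show "\<exists>(w :: 'k poly fract \<Rightarrow> 'g extended) (i :: 'k \<Rightarrow> 'k poly fract) x.
      immediate_extension v w i \<and> simple_extension i x \<and> transcendental_over i x \<and> appr v w i x = A"
    using immediate_extension_limit_value simple_extension_fract appr_limit_value[OF assms]
      transcendental_limit_point[OF valued_field_extension_limit_value limit_point_fract_X]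
    by blast
  fix w :: "'l \<Rightarrow> 'h extended" and i :: "'k \<Rightarrow> 'l" and x
    and u :: "'m \<Rightarrow> 'n extended" and j :: "'k \<Rightarrow> 'm" and y
  assume *: "immediate_extension v w i \<and> simple_extension i x \<and> transcendental_over i x \<and>
      appr v w i x = A \<and>
      valued_field_extension v u j \<and> simple_extension j y \<and> appr v u j y = A"
  have w: "valued_field_extension v w i"
    using * by (simp add: immediate_extension_def)
  have u: "valued_field_extension v u j"
    using * by simp
  have x: "limit_point w i x"
    using limit_point_if_appr[OF assms(2) w] * by simp
  have y: "limit_point u j y"
    using limit_point_if_appr[OF assms(2) u] * by simp
  show trans: "transcendental_over j y"
    by (rule transcendental_limit_point[OF u y])
  have "field_hom i" "field_hom j"
    using w u by (simp_all add: valued_field_extension_def)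
  then obtain \<phi> where "isomorphism_over i j \<phi> \<and> \<phi> x = y"
    using ex_isomorphism_over[of i x j y] * trans by blast
  moreover have "\<psi> = \<phi>'" if "isomorphism_over i j \<psi> \<and> \<psi> x = y"
    "isomorphism_over i j \<phi>' \<and> \<phi>' x = y" for \<psi> \<phi>'
    using that * by (intro isomorphism_over_unique[of i j \<psi> \<phi>' x]) auto
  ultimately show "\<exists>!\<phi>. isomorphism_over i j \<phi> \<and> \<phi> x = y"
    by blast
  show "valuation_preserving w u \<phi>" if "isomorphism_over i j \<phi> \<and> \<phi> x = y" for \<phi>
    using that * valuation_preserving_limit_points[OF transcendental_filter_axioms w x u y] by blast
qed

end
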